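(* Let $G$ be a compact connected Abelian topological group with normalized Haar measure $\mu$ ($\mu(G)=1$). Let $A,B,C\subset G$ be measurable and put $(a,b,c)=(\mu(A),\mu(B),\mu(C))$. Suppose that $$|a-b|\le c\le a+b\qquad\text{and}\qquad a+b+c\le 2 .$$ Then $$\int_C \mathbf 1_A*\mathbf 1_B\,d\mu\;\le\;\tfrac12(ab+bc+ca)-\tfrac14(a^2+b^2+c^2)\;=\;ab-\tfrac14(a+b-c)^2 .$$
   Context: Haar measure $\mu$ is assumed complete; measurable means $\mu$-measurable. $\mathbf 1_E$ is the indicator function of $E$. Convolution is $f*g(x)=\int_G f(x-y)g(y)\,d\mu(y)$. *)

theory Defs
  imports "HOL-Analysis.Analysis"
begin

text \<open>A Haar measure on an (additively written) Abelian topological group: a nonzero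
  translation-invariant Radon measure on the Borel sets, Radon meaning finite on compact sets,
  outer regular on Borel sets and inner regular on open sets. Regularity is not automatic,
  since the group need not be metrizable.\<close>

definition borel_haar_measure :: "'a::topological_ab_group_add measure \<Rightarrow> bool" where
  "borel_haar_measure N \<longleftrightarrow>
     sets N = sets borel \<and>
     emeasure N UNIV \<noteq> 0 \<and>
     (\<forall>x. \<forall>E\<in>sets borel. emeasure N ((+) x ` E) = emeasure N E) \<and>
     (\<forall>K. compact K \<longrightarrow> emeasure N K < \<infinity>) \<and>
     (\<forall>E\<in>sets borel. emeasure N E = (INF U\<in>{U. E \<subseteq> U \<and> open U}. emeasure N U)) \<and>
     (\<forall>U. open U \<longrightarrow> emeasure N U = (SUP K\<in>{K. K \<subseteq> U \<and> compact K}. emeasure N K))"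

definition haar_measure :: "'a::topological_ab_group_add measure \<Rightarrow> bool" where
  "haar_measure \<mu> \<longleftrightarrow> (\<exists>N. borel_haar_measure N \<and> \<mu> = completion N)"

definition group_convolution ::
    "'a::ab_group_add measure \<Rightarrow> ('a \<Rightarrow> real) \<Rightarrow> ('a \<Rightarrow> real) \<Rightarrow> 'a \<Rightarrow> real" where
  "group_convolution \<mu> f g x = (LINT y|\<mu>. f (x - y) * g y)"

end

theory Submission
  imports Defs
begin

text \<open>Splitting the convolution of the indicators of A and B at height t = (a + b - c) / 2 reduces
  the claim to the Kneser-Pollard inequality: the integral of min(1_A * 1_B, t) is at least
  t (a + b - t) for 0 \<le> t \<le> min(a, b) and a + b - t \<le> 1. For fixed B and t, the functional
  F(A) = (integral of min(1_A * 1_B, t)) - t a is translation invariant and, since min(., t) is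
  concave, submodular. By connectedness, the measure of the intersection of A with a translate of A
  takes every value between a^2 and a, so comparing A with the intersection and the union shows that
  the infimum of F over sets of measure a is locally midpoint concave in a. On the interval
  [t, 1 - b + t] it therefore dominates its boundary values, which both equal t (b - t).\<close>

section \<open>Uniform neighbourhoods around compact sets\<close>

text \<open>The tube lemma, applied to the open set of pairs \<open>(v, k)\<close> with
  \<open>k + v\<close> and \<open>k - v\<close> both in \<open>U\<close>, which contains
  \<open>{0} \<times> K\<close>.\<close>

lemma compact_translate_nbhd:
  fixes K U :: "'a::topological_ab_group_add set"
  assumes "compact K" "open U" "K \<subseteq> U"
  obtains V where "open V" "0 \<in> V"
    "\<forall>k\<in>K. \<forall>v\<in>V. k + v \<in> U \<and> k - v \<in> U"
proof -
  define W where "W = (\<lambda>p::'a \<times> 'a. snd p + fst p) -` U \<inter> (\<lambda>p. snd p - fst p) -` U"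
  have "open W"
    unfolding W_def
    by (intro open_Int open_vimage assms(2) continuous_intros)
  moreover have "{0} \<times> K \<subseteq> W" using assms(3) by (auto simp: W_def)
  ultimately obtain V where "0 \<in> V" "open V" "V \<times> K \<subseteq> W"
    using Elementary_Topology.tube_lemma[OF assms(1)] by metis
  then show thesis by (intro that[of V]) (auto simp: W_def)
qed

lemma uminus_image_eq: "uminus ` A = {y. - y \<in> A}" for A :: "'a::group_add set"
  by force

section \<open>Translation invariance of the Borel Haar measure\<close>

text \<open>The core argument runs on the Borel measure, where preimages under continuous maps are
  measurable at once; the completion enters only at the end.\<close>

locale compact_borel_haar = finite_measure N for N :: "'a::topological_ab_group_add measure" +
  assumes compact_UNIV: "compact (UNIV :: 'a set)"
    and haar: "borel_haar_measure N"
    and total: "emeasure N UNIV = 1"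
begin

lemma sets_N [simp, measurable_cong]: "sets N = sets borel"
  using haar by (simp add: borel_haar_measure_def)

lemma space_N [simp]: "space N = UNIV"
  using sets_eq_imp_space_eq[OF sets_N] by simp

lemma measure_UNIV [simp]: "measure N UNIV = 1"
  using total by (simp add: measure_def)

lemma measure_le_1: "measure N A \<le> 1"
  using bounded_measure[of A] by simp

lemma measure_Compl: "A \<in> sets borel \<Longrightarrow> measure N (- A) = 1 - measure N A"
  using finite_measure_compl[of A] by (simp add: Compl_eq_Diff_UNIV)

lemma borel_measurable_N_continuous: "continuous_on UNIV f \<Longrightarrow> f \<in> borel_measurable N"
  using measurable_cong_sets[OF sets_N refl] borel_measurable_continuous_onI by blast

lemma vimage_diff_borel [measurable]:
  assumes "A \<in> sets borel" shows "{y::'a. x - y \<in> A} \<in> sets borel" "{y::'a. y - x \<in> A} \<in> sets borel"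
    "uminus ` A \<in> sets borel"
proof -
  have *: "f -` A \<in> sets borel" if "continuous_on UNIV f" for f :: "'a \<Rightarrow> 'a"
    using measurable_sets[OF borel_measurable_continuous_onI[OF that] assms] by simp
  show "{y. x - y \<in> A} \<in> sets borel" "{y. y - x \<in> A} \<in> sets borel"
    using *[of "\<lambda>y. x - y"] *[of "\<lambda>y. y - x"] by (simp_all add: vimage_def continuous_intros)
  show "uminus ` A \<in> sets borel"
    using *[of uminus] by (simp add: uminus_image_eq vimage_def continuous_intros)
qed

lemma translate_image_eq: "(+) x ` A = {y::'a. y - x \<in> A}"
  by (auto simp: image_iff) (metis add_diff_cancel_left' diff_add_cancel add.commute)

lemma emeasure_translate: "A \<in> sets borel \<Longrightarrow> emeasure N {y. y - x \<in> A} = emeasure N A"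
proof -
  assume A: "A \<in> sets borel"
  have "\<forall>x. \<forall>E\<in>sets borel. emeasure N ((+) x ` E) = emeasure N E"
    using haar unfolding borel_haar_measure_def by (elim conjE)
  then have "emeasure N ((+) x ` A) = emeasure N A" using A by blast
  then show ?thesis by (simp only: translate_image_eq)
qed

lemma measure_translate: "A \<in> sets borel \<Longrightarrow> measure N {y. y - x \<in> A} = measure N A"
  by (simp add: measure_def emeasure_translate)

lemma distr_translate: "distr N N (\<lambda>y. y + x) = N"
proof (rule measure_eqI)
  fix A assume "A \<in> sets (distr N N (\<lambda>y. y + x))"
  then have A: "A \<in> sets borel" by simp
  have m: "(\<lambda>y. y + x) \<in> measurable N N"
    using borel_measurable_continuous_onI[of "\<lambda>y. y + x"]
    by (simp add: measurable_cong_sets[OF sets_N sets_N] continuous_intros)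
  have "(\<lambda>y. y + x) -` A = {y. y - (- x) \<in> A}" by auto
  then have "emeasure N ((\<lambda>y. y + x) -` A) = emeasure N A"
    using emeasure_translate[OF A, of "- x"] by simp
  then show "emeasure (distr N N (\<lambda>y. y + x)) A = emeasure N A"
    using A m by (simp add: emeasure_distr)
qed simp

lemma integral_translate:
  fixes f :: "'a \<Rightarrow> real"
  assumes "f \<in> borel_measurable N"
  shows "(LINT y|N. f (y - x)) = (LINT y|N. f y)"
proof -
  have m: "(\<lambda>y. y + - x) \<in> measurable N N"
    using borel_measurable_continuous_onI[of "\<lambda>y. y + - x"]
    by (simp add: measurable_cong_sets[OF sets_N sets_N] continuous_intros)
  have "(LINT y|N. f y) = (LINT y|distr N N (\<lambda>y. y + - x). f y)"
    by (simp only: distr_translate)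
  also have "\<dots> = (LINT y|N. f (y - x))"
    using integral_distr[OF m, of f] assms by simp
  finally show ?thesis by simp
qed

section \<open>Regularity\<close>

lemma outer_open:
  assumes "A \<in> sets borel" "e > 0"
  obtains U where "open U" "A \<subseteq> U" "measure N U < measure N A + e"
proof -
  have "\<forall>E\<in>sets borel. emeasure N E = (INF U\<in>{U. E \<subseteq> U \<and> open U}. emeasure N U)"
    using haar unfolding borel_haar_measure_def by (elim conjE)
  then have "emeasure N A = (INF U\<in>{U. A \<subseteq> U \<and> open U}. emeasure N U)"
    using assms(1) by (rule bspec)
  moreover have "emeasure N A < ennreal (measure N A + e)"
    using assms(2) by (simp add: emeasure_eq_measure ennreal_lessI)
  ultimately obtain U where "A \<subseteq> U" "open U" "emeasure N U < ennreal (measure N A + e)"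
    by (auto simp: INF_less_iff)
  then show thesis
    using that[of U] assms(2)
    by (simp add: emeasure_eq_measure ennreal_less_iff del: ennreal_plus)
qed

text \<open>Outer regularity of the complement: as \<open>N\<close> is finite, this yields inner
  approximation of every Borel set, while the definition postulates it for open sets only.\<close>

lemma inner_closed:
  assumes "A \<in> sets borel" "e > 0"
  obtains K where "closed K" "K \<subseteq> A" "measure N A < measure N K + e"
proof -
  obtain U where U: "open U" "- A \<subseteq> U" "measure N U < measure N (- A) + e"
    using assms by (auto intro: outer_open[of "- A" e])
  then have "measure N A < measure N (- U) + e"
    using assms by (simp add: measure_Compl)
  then show thesis using U by (intro that[of "- U"]) auto
qed

lemma sandwich:
  assumes "A \<in> sets borel" "e > 0"
  obtains K U where "closed K" "open U" "K \<subseteq> A" "A \<subseteq> U" "measure N (U - K) < e"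
proof -
  have e: "e/2 > 0" using assms(2) by simp
  obtain U where U: "open U" "A \<subseteq> U" "measure N U < measure N A + e/2"
    by (rule outer_open[OF assms(1) e])
  obtain K where K: "closed K" "K \<subseteq> A" "measure N A < measure N K + e/2"
    by (rule inner_closed[OF assms(1) e])
  have "measure N (U - K) = measure N U - measure N K"
    using U K by (intro finite_measure_Diff) auto
  then show thesis using U K by (intro that[of K U]) auto
qed

section \<open>Convolution of indicators and a one-sided Fubini bound\<close>

text \<open>The convolution 1_A * 1_B at \<open>x\<close>, written as a measure so that its
  pointwise properties reduce to set identities.\<close>

definition set_conv :: "'a set \<Rightarrow> 'a set \<Rightarrow> 'a \<Rightarrow> real" where
  "set_conv A B x = measure N {y \<in> B. x - y \<in> A}"

lemma set_conv_sets: "(A::'a set) \<in> sets borel \<Longrightarrow> B \<in> sets borel \<Longrightarrow> {y \<in> B. x - y \<in> A} \<in> sets borel"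
  using sets.Int[of B borel "{y. x - y \<in> A}"] vimage_diff_borel(1)[of A x]
  by (simp add: Int_def)

lemma closed_compact: "closed (K :: 'a set) \<Longrightarrow> compact K"
  using compact_Int_closed[OF compact_UNIV, of K] by simp

text \<open>A Fubini inequality that avoids the product measure: the Borel sets of the group need not
  generate those of its square, so subtraction need not be jointly measurable.\<close>

lemma set_conv_minorant_cover:
  assumes "finite D" "closed K" "U \<in> sets borel" "V \<in> sets borel"
    and KV: "\<And>k v. k \<in> K \<Longrightarrow> v \<in> V \<Longrightarrow> k - v \<in> U"
    and "B \<in> sets borel" "B \<subseteq> (\<Union>d\<in>D. {y. y - d \<in> V})"
  shows "\<exists>g. integrable N g \<and> (\<forall>x. g x \<le> set_conv U B x) \<and> (LINT x|N. g x) = measure N K * measure N B"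
  using assms(1,6,7)
proof (induction D arbitrary: B rule: finite_induct)
  case empty
  then show ?case by (intro exI[of _ "\<lambda>_. 0"]) (auto simp: set_conv_def)
next
  case (insert d D)
  let ?V = "{y. y - d \<in> V}"
  have V [measurable]: "?V \<in> sets borel" using assms(4) by (rule vimage_diff_borel)
  have B [measurable]: "B \<in> sets borel" by fact
  have "B - ?V \<in> sets borel" "B - ?V \<subseteq> (\<Union>d\<in>D. {y. y - d \<in> V})" using insert.prems by auto
  then obtain g where g: "integrable N g" "\<And>x. g x \<le> set_conv U (B - ?V) x"
    "(LINT x|N. g x) = measure N K * measure N (B - ?V)"
    using insert.IH[of "B - ?V"] by auto
  let ?K = "{x. x - d \<in> K}"
  have K: "?K \<in> sets borel" using assms(2) by (intro vimage_diff_borel) auto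
  \<comment> \<open>For \<open>x\<close> in \<open>?K\<close> and \<open>y\<close> in
    \<open>?V\<close>, the element \<open>x - y = (x - d) - (y - d)\<close> lies in
    \<open>U\<close>, so all of \<open>B \<inter> ?V\<close> is counted at \<open>x\<close>.\<close>
  define g' where "g' x = g x + measure N (B \<inter> ?V) * indicator ?K x" for x
  have i: "integrable N (indicator ?K :: _ \<Rightarrow> real)"
    using K by (intro integrable_real_indicator) (auto simp: emeasure_eq_measure)
  have "integrable N g'" unfolding g'_def using g(1) i by simp
  moreover have "(LINT x|N. g' x) = measure N K * measure N B"
  proof -
    have "(LINT x|N. g' x) = measure N K * measure N (B - ?V) + measure N (B \<inter> ?V) * measure N ?K"
      unfolding g'_def using g i K by simp
    also have "measure N ?K = measure N K" using assms(2) by (intro measure_translate) auto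
    also have "measure N B = measure N (B - ?V) + measure N (B \<inter> ?V)"
      by (subst finite_measure_Union[symmetric]) (auto intro!: arg_cong[of _ _ "measure N"])
    ultimately show ?thesis by (simp add: algebra_simps)
  qed
  moreover have "g' x \<le> set_conv U B x" for x
  proof -
    have "set_conv U B x = set_conv U (B - ?V) x + set_conv U (B \<inter> ?V) x"
    proof -
      have "{y \<in> B. x - y \<in> U} = {y \<in> B - ?V. x - y \<in> U} \<union> {y \<in> B \<inter> ?V. x - y \<in> U}" by blast
      moreover have "{y \<in> B - ?V. x - y \<in> U} \<inter> {y \<in> B \<inter> ?V. x - y \<in> U} = {}" by blast
      moreover have "B - ?V \<in> sets borel" "B \<inter> ?V \<in> sets borel" by auto
      ultimately show ?thesis
        unfolding set_conv_def using set_conv_sets[OF assms(3)]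
        by (simp only: finite_measure_Union sets_N)
    qed
    moreover have "set_conv U (B \<inter> ?V) x \<ge> measure N (B \<inter> ?V) * indicator ?K x"
    proof (cases "x \<in> ?K")
      case True
      then have "{y \<in> B \<inter> ?V. x - y \<in> U} = B \<inter> ?V"
        using KV[of "x - d" "_ - d"] by auto
      then show ?thesis using True by (simp add: set_conv_def)
    qed (simp add: set_conv_def)
    ultimately show ?thesis using g(2)[of x] by (simp add: g'_def)
  qed
  ultimately show ?case by blast
qed

text \<open>Compactness covers the group by finitely many translates of a neighbourhood
  \<open>V\<close> of 0 with \<open>K - V\<close> inside \<open>U\<close>, which reduces this to the
  finite induction.\<close>

lemma set_conv_minorant:
  assumes "closed K" "open U" "K \<subseteq> U" "B \<in> sets borel"
  shows "\<exists>g. integrable N g \<and> (\<forall>x. g x \<le> set_conv U B x) \<and> (LINT x|N. g x) = measure N K * measure N B"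
proof -
  obtain V where V: "open V" "0 \<in> V" "\<forall>k\<in>K. \<forall>v\<in>V. k + v \<in> U \<and> k - v \<in> U"
    by (rule compact_translate_nbhd[OF closed_compact[OF assms(1)] assms(2,3)])
  have o: "open {y. y - d \<in> V}" for d
    using open_vimage[of V "\<lambda>y. y - d"] V(1) by (simp add: vimage_def continuous_intros)
  have c: "UNIV \<subseteq> (\<Union>d\<in>UNIV. {y. y - d \<in> V})"
  proof
    fix y show "y \<in> (\<Union>d\<in>UNIV. {y. y - d \<in> V})" using V(2) by (intro UN_I[of y]) auto
  qed
  obtain D where D: "D \<subseteq> UNIV" "finite D" "UNIV \<subseteq> (\<Union>d\<in>D. {y. y - d \<in> V})"
    by (rule compactE_image[OF compact_UNIV o c])
  have "B \<subseteq> (\<Union>d\<in>D. {y. y - d \<in> V})" using D(3) by blast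
  moreover have "k - v \<in> U" if "k \<in> K" "v \<in> V" for k v using V(3) that by blast
  ultimately show ?thesis
    using set_conv_minorant_cover[OF D(2) assms(1) borel_open[OF assms(2)] borel_open[OF V(1)] _ assms(4)]
    by blast
qed

section \<open>Invariance under inversion\<close>

lemma measure_uminus_open:
  assumes "open U"
  shows "measure N U \<le> measure N (uminus ` U)"
proof (rule field_le_epsilon)
  fix e :: real assume "e > 0"
  then obtain K where K: "closed K" "K \<subseteq> U" "measure N U < measure N K + e"
    by (rule inner_closed[OF borel_open[OF assms]])
  obtain g where g: "integrable N g" "\<And>x. g x \<le> set_conv U UNIV x" "(LINT x|N. g x) = measure N K"
    using set_conv_minorant[OF K(1) assms K(2), of UNIV] by auto
  have "set_conv U UNIV x = measure N (uminus ` U)" for x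
  proof -
    have "{y. x - y \<in> U} = {y. y - x \<in> uminus ` U}"
      by (simp add: uminus_image_eq)
    then show ?thesis using measure_translate[of "uminus ` U" x] assms
      by (simp add: set_conv_def vimage_diff_borel)
  qed
  then have "(LINT x|N. g x) \<le> (LINT x|N. measure N (uminus ` U))"
    using g by (intro integral_mono) auto
  then show "measure N U \<le> measure N (uminus ` U) + e" using g K by simp
qed

lemma measure_uminus:
  assumes A: "A \<in> sets borel"
  shows "measure N (uminus ` A) = measure N A"
proof -
  have le: "measure N (uminus ` A) \<le> measure N A" if A: "A \<in> sets borel" for A
  proof (rule field_le_epsilon)
    fix e :: real assume "e > 0"
    then obtain U where U: "open U" "A \<subseteq> U" "measure N U < measure N A + e"
      by (rule outer_open[OF A])
    have "open (uminus ` U)" using open_vimage[of U uminus] U(1)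
      by (simp add: uminus_image_eq vimage_def continuous_intros)
    then have "measure N (uminus ` U) \<le> measure N U"
      using measure_uminus_open[of "uminus ` U"] by (simp add: image_image)
    moreover have "measure N (uminus ` A) \<le> measure N (uminus ` U)"
      using U vimage_diff_borel by (intro finite_measure_mono) auto
    ultimately show "measure N (uminus ` A) \<le> measure N A + e" using U(3) by simp
  qed
  from le[OF A] le[of "uminus ` A"] vimage_diff_borel(3)[OF A] show ?thesis
    by (simp add: image_image)
qed

lemma measure_reflect:
  assumes "A \<in> sets borel"
  shows "measure N {y. x - y \<in> A} = measure N A"
proof -
  have "{y. x - y \<in> A} = {y. y - x \<in> uminus ` A}"
    by (simp add: uminus_image_eq)
  then show ?thesis
    using measure_translate[of "uminus ` A" x] measure_uminus[OF assms] assms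
    by (simp add: vimage_diff_borel)
qed

lemma set_conv_le: "A \<in> sets borel \<Longrightarrow> B \<in> sets borel \<Longrightarrow> set_conv A B x \<le> measure N A"
  unfolding set_conv_def measure_reflect[of A x, symmetric]
  by (intro finite_measure_mono) (auto simp: vimage_diff_borel)

lemma set_conv_nonneg: "0 \<le> set_conv A B x"
  by (simp add: set_conv_def)

lemma set_conv_Compl:
  assumes "A \<in> sets borel" "B \<in> sets borel"
  shows "set_conv (- A) B x = measure N B - set_conv A B x"
proof -
  have "{y \<in> B. x - y \<in> - A} = B - {y \<in> B. x - y \<in> A}" by blast
  then show ?thesis
    unfolding set_conv_def using set_conv_sets[OF assms] assms
    by (simp only: sets_N finite_measure_Diff[of B] mem_Collect_eq subset_eq)
       (auto intro!: finite_measure_Diff)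
qed

section \<open>Continuity and integral of the convolution\<close>

text \<open>If \<open>y\<close> is counted at \<open>x\<close> but not at \<open>x + d\<close>, then
  \<open>x - y\<close> or \<open>x + d - y\<close> lies in \<open>U - K\<close>. Each case confines
  \<open>y\<close> to a reflected translate of \<open>U - K\<close>, which has the same
  measure.\<close>

lemma set_conv_almost_periodic:
  assumes "A \<in> sets borel" "B \<in> sets borel" "closed K" "open U" "K \<subseteq> A" "A \<subseteq> U"
    and d: "\<forall>k\<in>K. k + d \<in> U"
  shows "set_conv A B x \<le> set_conv A B (x + d) + 2 * measure N (U - K)"
proof -
  have UK: "U - K \<in> sets borel" using assms by auto
  let ?E = "{y \<in> B. x + d - y \<in> A}"
  let ?R = "\<lambda>x. {y. x - y \<in> U - K}"
  have sets: "?E \<in> sets N" "?R x \<in> sets N" for x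
    using set_conv_sets[OF assms(1,2)] vimage_diff_borel(1)[OF UK] by simp_all
  have "{y \<in> B. x - y \<in> A} \<subseteq> (?E \<union> ?R x) \<union> ?R (x + d)"
  proof
    fix y assume y: "y \<in> {y \<in> B. x - y \<in> A}"
    have "x - y \<in> K \<Longrightarrow> x + d - y \<in> U"
      using d by (metis add_diff_eq add.commute)
    then show "y \<in> (?E \<union> ?R x) \<union> ?R (x + d)" using y assms(5,6) by blast
  qed
  then have "set_conv A B x \<le> measure N ((?E \<union> ?R x) \<union> ?R (x + d))"
    unfolding set_conv_def using sets by (intro finite_measure_mono sets.Un)
  also have "\<dots> \<le> measure N (?E \<union> ?R x) + measure N (?R (x + d))"
    using sets by (intro measure_Un_le sets.Un)
  also have "measure N (?E \<union> ?R x) \<le> measure N ?E + measure N (?R x)"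
    using sets by (intro measure_Un_le)
  finally show ?thesis
    unfolding measure_reflect[OF UK] set_conv_def by linarith
qed

lemma continuous_set_conv:
  assumes "A \<in> sets borel" "B \<in> sets borel"
  shows "continuous_on UNIV (set_conv A B)"
  unfolding continuous_on_def
proof (intro ballI tendstoI)
  fix x and e :: real assume "e > 0"
  then have e: "e/2 > 0" by simp
  obtain K U where KU: "closed K" "open U" "K \<subseteq> A" "A \<subseteq> U" "measure N (U - K) < e/2"
    by (rule sandwich[OF assms(1) e])
  have "K \<subseteq> U" using KU by blast
  then obtain V where V: "open V" "0 \<in> V" "\<forall>k\<in>K. \<forall>v\<in>V. k + v \<in> U \<and> k - v \<in> U"
    by (rule compact_translate_nbhd[OF closed_compact[OF KU(1)] KU(2)])
  have o: "open {y. y - x \<in> V}"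
    using open_vimage[of V "\<lambda>y. y - x"] V(1) by (simp add: vimage_def continuous_intros)
  have close: "dist (set_conv A B y) (set_conv A B x) < e" if "y - x \<in> V" for y
  proof -
    have 1: "\<forall>k\<in>K. k + (y - x) \<in> U" using V(3) that by blast
    \<comment> \<open>The subtraction half of the neighbourhood property supplies the reverse shift,
      so \<open>V\<close> need not be symmetric.\<close>
    have "k + (x - y) = k - (y - x)" for k by (simp add: algebra_simps)
    then have 2: "\<forall>k\<in>K. k + (x - y) \<in> U" using V(3) that by metis
    note per = set_conv_almost_periodic[OF assms KU(1-4)]
    have "set_conv A B x \<le> set_conv A B (x + (y - x)) + 2 * measure N (U - K)"
      "set_conv A B y \<le> set_conv A B (y + (x - y)) + 2 * measure N (U - K)"
      using per[OF 1] per[OF 2] by blast+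
    then show ?thesis using KU(5) by (simp add: dist_real_def)
  qed
  show "\<forall>\<^sub>F y in at x within UNIV. dist (set_conv A B y) (set_conv A B x) < e"
    unfolding eventually_at_topological using o V(2) close
    by (intro exI[of _ "{y. y - x \<in> V}"]) auto
qed

lemma measurable_set_conv: "A \<in> sets borel \<Longrightarrow> B \<in> sets borel \<Longrightarrow> set_conv A B \<in> borel_measurable N"
  by (intro borel_measurable_N_continuous continuous_set_conv)

lemma integrable_set_conv:
  assumes "A \<in> sets borel" "B \<in> sets borel"
  shows "integrable N (set_conv A B)"
  using measurable_set_conv[OF assms] set_conv_nonneg set_conv_le[OF assms]
  by (intro integrable_const_bound[where B = "measure N A"]) auto

lemma integrable_min_set_conv:
  assumes "A \<in> sets borel" "B \<in> sets borel"
  shows "integrable N (\<lambda>x. min (set_conv A B x) t)"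
  by (intro Bochner_Integration.integrable_min integrable_set_conv assms) auto

text \<open>The minorants give the lower bound. Since the convolutions of \<open>A\<close> and
  \<open>- A\<close> with \<open>B\<close> add up to \<open>measure N B\<close>, the lower bound for
  \<open>- A\<close> is the upper bound for \<open>A\<close>.\<close>

lemma integral_set_conv:
  assumes "A \<in> sets borel" "B \<in> sets borel"
  shows "(LINT x|N. set_conv A B x) = measure N A * measure N B"
proof -
  have lower: "measure N A * measure N B \<le> (LINT x|N. set_conv A B x)" if A: "A \<in> sets borel" for A
  proof (rule field_le_epsilon)
    fix e :: real assume "e > 0"
    \<comment> \<open>One half of \<open>e\<close> pays for replacing \<open>U\<close> by
      \<open>A\<close> in the convolution, the other for replacing \<open>A\<close> by
      \<open>K\<close> in the measure.\<close>
    then have e: "e/2 > 0" by simp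
    obtain K U where KU: "closed K" "open U" "K \<subseteq> A" "A \<subseteq> U" "measure N (U - K) < e/2"
      by (rule sandwich[OF A e])
    have UK: "U - K \<in> sets borel" using KU by auto
    have "K \<subseteq> U" using KU by blast
    then obtain g where g: "integrable N g" "\<forall>x. g x \<le> set_conv U B x"
      "(LINT x|N. g x) = measure N K * measure N B"
      using set_conv_minorant[OF KU(1,2) _ assms(2)] by blast
    have "g x \<le> set_conv A B x + e/2" for x
    proof -
      have "{y \<in> B. x - y \<in> U} \<subseteq> {y \<in> B. x - y \<in> A} \<union> {y \<in> B. x - y \<in> U - K}"
        using KU by blast
      then have "set_conv U B x \<le> measure N ({y \<in> B. x - y \<in> A} \<union> {y \<in> B. x - y \<in> U - K})"
        unfolding set_conv_def using set_conv_sets[OF A assms(2)] set_conv_sets[OF UK assms(2)]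
        by (intro finite_measure_mono) (simp_all only: sets_N sets.Un)
      also have "\<dots> \<le> set_conv A B x + set_conv (U - K) B x"
        unfolding set_conv_def using set_conv_sets[OF A assms(2)] set_conv_sets[OF UK assms(2)]
        by (intro measure_Un_le) (simp_all only: sets_N)
      also have "set_conv (U - K) B x \<le> e/2" using set_conv_le[OF UK assms(2), of x] KU(5) by simp
      finally show ?thesis using g(2) by (meson add_left_mono order_trans)
    qed
    then have "(LINT x|N. g x) \<le> (LINT x|N. set_conv A B x + e/2)"
      using g(1) integrable_set_conv[OF A assms(2)] by (intro integral_mono) auto
    also have "\<dots> = (LINT x|N. set_conv A B x) + e/2"
      using integrable_set_conv[OF A assms(2)] by simp
    finally have 1: "measure N K * measure N B \<le> (LINT x|N. set_conv A B x) + e/2" using g(3) by simp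
    have "measure N A \<le> measure N (K \<union> (U - K))"
      using KU UK by (intro finite_measure_mono) auto
    also have "\<dots> \<le> measure N K + measure N (U - K)"
      using KU UK by (intro measure_Un_le) auto
    finally have "measure N A \<le> measure N K + e/2" using KU(5) by simp
    then have "measure N A * measure N B \<le> (measure N K + e/2) * measure N B"
      by (intro mult_right_mono) auto
    also have "\<dots> \<le> measure N K * measure N B + e/2"
      using mult_left_mono[OF measure_le_1[of B], of "e/2"] e by (simp add: algebra_simps)
    finally show "measure N A * measure N B \<le> (LINT x|N. set_conv A B x) + e" using 1 by simp
  qed
  have "measure N (- A) * measure N B \<le> (LINT x|N. set_conv (- A) B x)" using assms by (intro lower) auto
  also have "\<dots> = measure N B - (LINT x|N. set_conv A B x)"
    using integrable_set_conv[OF assms] by (simp add: set_conv_Compl[OF assms])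
  finally show ?thesis using lower[OF assms(1)] measure_Compl[OF assms(1)]
    by (simp add: algebra_simps)
qed

section \<open>Intersections with translates and truncated convolutions\<close>

text \<open>The measure of the intersection is a continuous function of \<open>x\<close> with mean
  \<open>(measure N A)\<^sup>2\<close> and value \<open>measure N A\<close> at 0. Some value is
  below \<open>r\<close>, since otherwise the mean would be at least \<open>r\<close>; connectedness
  then gives the intermediate value.\<close>

lemma exists_translate_Int:
  assumes "connected (UNIV :: 'a set)" "A \<in> sets borel"
    and "(measure N A)\<^sup>2 < r" "r \<le> measure N A"
  shows "\<exists>x. measure N (A \<inter> {y. y - x \<in> A}) = r"
proof -
  let ?f = "set_conv (uminus ` A) A"
  have f: "?f x = measure N (A \<inter> {y. y - x \<in> A})" for x
    unfolding set_conv_def by (rule arg_cong[of _ _ "measure N"]) (auto simp: uminus_image_eq)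
  have m: "uminus ` A \<in> sets borel" using assms(2) by (rule vimage_diff_borel)
  have "connected (range ?f)"
    using connected_continuous_image[OF continuous_set_conv[OF m assms(2)] assms(1)] .
  moreover have "\<exists>x. ?f x < r"
  proof (rule ccontr)
    assume "\<not> (\<exists>x. ?f x < r)"
    then have "(LINT x|N. r) \<le> (LINT x|N. ?f x)"
      by (intro integral_mono integrable_set_conv m assms(2)) (auto simp: not_less)
    then show False
      using assms(3) by (simp add: integral_set_conv[OF m assms(2)] measure_uminus[OF assms(2)] power2_eq_square)
  qed
  moreover have "r \<le> ?f 0" using assms(4) by (simp add: f)
  ultimately have "r \<in> range ?f"
    unfolding connected_iff_interval by (meson less_imp_le rangeI)
  then show ?thesis using f by auto
qed

lemma set_conv_modular:
  assumes "A \<in> sets borel" "A' \<in> sets borel" "B \<in> sets borel"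
  shows "set_conv (A \<inter> A') B x + set_conv (A \<union> A') B x = set_conv A B x + set_conv A' B x"
proof -
  let ?S = "\<lambda>A. {y \<in> B. x - y \<in> A}"
  have "?S (A \<inter> A') = ?S A \<inter> ?S A'" "?S (A \<union> A') = ?S A \<union> ?S A'" by auto
  moreover have "measure N (?S A \<union> ?S A') + measure N (?S A \<inter> ?S A') = measure N (?S A) + measure N (?S A')"
    using set_conv_sets[OF assms(1,3)] set_conv_sets[OF assms(2,3)]
    by (subst measure_Un3) (auto simp: fmeasurable_eq_sets)
  ultimately show ?thesis by (simp add: set_conv_def)
qed

lemma set_conv_mono:
  "A \<subseteq> A' \<Longrightarrow> A' \<in> sets borel \<Longrightarrow> B \<in> sets borel \<Longrightarrow> set_conv A B x \<le> set_conv A' B x"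
  unfolding set_conv_def using set_conv_sets by (intro finite_measure_mono) auto

lemma set_conv_translate: "set_conv {y. y - z \<in> A} B x = set_conv A B (x - z)"
  unfolding set_conv_def by (simp add: diff_diff_eq add.commute)

text \<open>Both the convolution f and \<open>t\<close> are at most \<open>measure N A\<close>, so
  \<open>t * f <= measure N A * min f t\<close> pointwise; integrate and cancel. This controls the
  end \<open>measure N A = t\<close> of the interval.\<close>

lemma min_set_conv_ge_left:
  assumes "A \<in> sets borel" "B \<in> sets borel" "0 \<le> t" "t \<le> measure N A"
  shows "t * measure N B \<le> (LINT x|N. min (set_conv A B x) t)"
proof (cases "measure N A = 0")
  case True
  then have "t = 0" using assms by simp
  then show ?thesis using set_conv_nonneg by simp
next
  case False
  then have pos: "measure N A > 0" by (simp add: zero_less_measure_iff)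
  have "t * set_conv A B x \<le> measure N A * min (set_conv A B x) t" for x
    using mult_right_mono[OF assms(4) set_conv_nonneg[of A B x]]
      mult_right_mono[OF set_conv_le[OF assms(1,2), of x] assms(3)]
    by (auto simp: min_def mult.commute)
  then have "(LINT x|N. t * set_conv A B x) \<le> (LINT x|N. measure N A * min (set_conv A B x) t)"
    by (intro integral_mono integrable_mult_right integrable_set_conv integrable_min_set_conv assms)
  then have "measure N A * (t * measure N B) \<le> measure N A * (LINT x|N. min (set_conv A B x) t)"
    by (simp add: integral_set_conv[OF assms(1,2)] mult.left_commute)
  then show ?thesis using pos by (simp add: mult_le_cancel_left_pos)
qed

text \<open>The convolution with \<open>- A\<close> is at most \<open>1 - measure N A\<close>, which
  bounds the one with \<open>A\<close> from below everywhere. This controls the end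
  \<open>measure N A = 1 - measure N B + t\<close>.\<close>

lemma min_set_conv_ge_right:
  assumes "A \<in> sets borel" "B \<in> sets borel" "measure N A + measure N B - 1 \<le> t"
  shows "measure N A + measure N B - 1 \<le> (LINT x|N. min (set_conv A B x) t)"
proof -
  have "measure N A + measure N B - 1 \<le> min (set_conv A B x) t" for x
    using set_conv_le[of "- A" B x] assms by (simp add: set_conv_Compl measure_Compl)
  then have "(LINT x|N. measure N A + measure N B - 1) \<le> (LINT x|N. min (set_conv A B x) t)"
    by (intro integral_mono integrable_min_set_conv assms) auto
  then show ?thesis by simp
qed

text \<open>At each point the values for intersection and union have the same sum as those for
  \<open>A\<close> and \<open>A'\<close> but are spread at least as far apart, so the concave
  function \<open>min\<close> with \<open>t\<close> has no larger sum there.\<close>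

lemma min_set_conv_submodular:
  assumes "A \<in> sets borel" "A' \<in> sets borel" "B \<in> sets borel"
  shows "(LINT x|N. min (set_conv (A \<inter> A') B x) t) + (LINT x|N. min (set_conv (A \<union> A') B x) t)
    \<le> (LINT x|N. min (set_conv A B x) t) + (LINT x|N. min (set_conv A' B x) t)"
proof -
  have "min (set_conv (A \<inter> A') B x) t + min (set_conv (A \<union> A') B x) t \<le> min (set_conv A B x) t + min (set_conv A' B x) t" for x
    using set_conv_modular[OF assms, of x] set_conv_mono[of "A \<inter> A'" A B x] set_conv_mono[of "A \<inter> A'" A' B x] assms
    by (auto simp: min_def)
  then have "(LINT x|N. min (set_conv (A \<inter> A') B x) t + min (set_conv (A \<union> A') B x) t)
      \<le> (LINT x|N. min (set_conv A B x) t + min (set_conv A' B x) t)"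
    using assms by (intro integral_mono Bochner_Integration.integrable_add integrable_min_set_conv) auto
  then show ?thesis using assms integrable_min_set_conv by (simp add: sets.Int sets.Un)
qed

section \<open>The Kneser-Pollard inequality\<close>

text \<open>A counterexample pushes the infimum of a perturbed \<open>F\<close> well below its
  boundary bound. A near-minimiser then has measure away from both ends, and its intersection and
  union with a suitable translate remain admissible and have too small a sum.\<close>

theorem kneser_pollard:
  assumes conn: "connected (UNIV :: 'a set)"
    and A0: "A0 \<in> sets borel" and B: "B \<in> sets borel"
    and t: "0 \<le> t" "t \<le> measure N B" "t \<le> measure N A0" "measure N A0 + measure N B - t \<le> 1"
  shows "t * (measure N A0 + measure N B - t) \<le> (LINT x|N. min (set_conv A0 B x) t)"
proof (rule ccontr)
  define b where "b = measure N B"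
  define F where "F A = (LINT x|N. min (set_conv A B x) t) - t * measure N A" for A
  \<comment> \<open>The common lower bound for \<open>F\<close> at \<open>measure N A = t\<close>
    and at \<open>measure N A = 1 - b + t\<close>; the negated claim amounts to
    \<open>F A0 < v\<close>.\<close>
  define v where "v = t * (b - t)"
  define good where "good A \<longleftrightarrow> A \<in> sets borel \<and> t \<le> measure N A \<and> measure N A + b - t \<le> 1" for A
  assume "\<not> ?thesis"
  then have "F A0 < v" by (simp add: F_def v_def b_def algebra_simps)
  define \<delta> where "\<delta> = v - F A0"
  have \<delta>: "\<delta> > 0" using \<open>F A0 < v\<close> by (simp add: \<delta>_def)
  \<comment> \<open>The near-minimiser will have measure \<open>a\<close> with \<open>a\<close> and
    \<open>1 - a\<close> at least \<open>\<delta>/4\<close>. Hence \<open>a - a\<^sup>2\<close> is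
    at least \<open>(\<delta>/4)\<^sup>2\<close>, and half of that makes
    \<open>a\<^sup>2 < a - s\<close> strict; \<open>s <= \<delta>/4\<close> keeps
    \<open>a - s\<close> and \<open>a + s\<close> in the interval.\<close>
  define s where "s = (\<delta>/4)\<^sup>2 / 2"
  have s: "s > 0" using \<delta> by (simp add: s_def)
  \<comment> \<open>The quadratic term turns midpoint concavity of F into strict concavity, so that an
    approximate minimiser already gives a contradiction.\<close>
  define \<phi> where "\<phi> A = F A - \<delta>/2 * (measure N A)\<^sup>2" for A
  have t1: "t \<le> 1" using t(2) measure_le_1[of B] by simp
  \<comment> \<open>Here and in \<open>F_right\<close>, \<open>F\<close> falls below
    \<open>v\<close> by at most the distance to an end of the interval.\<close>
  have F_left: "v - (measure N A - t) \<le> F A" if "good A" for A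
  proof -
    have "t * b \<le> (LINT x|N. min (set_conv A B x) t)"
      unfolding b_def using that B t(1) by (intro min_set_conv_ge_left) (auto simp: good_def)
    moreover have "t * (measure N A - t) \<le> 1 * (measure N A - t)"
      using that t1 by (intro mult_right_mono) (auto simp: good_def)
    ultimately show ?thesis by (simp add: F_def v_def algebra_simps)
  qed
  have F_right: "v - (1 - b + t - measure N A) \<le> F A" if "good A" for A
  proof -
    have "measure N A + b - 1 \<le> (LINT x|N. min (set_conv A B x) t)"
      unfolding b_def using that B by (intro min_set_conv_ge_right) (auto simp: good_def b_def)
    moreover have "0 \<le> t * (1 - b + t - measure N A)"
      using that t(1) by (intro mult_nonneg_nonneg) (auto simp: good_def)
    ultimately show ?thesis by (simp add: F_def v_def algebra_simps)
  qed
  have sq: "(measure N A)\<^sup>2 \<le> 1" for A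
    using measure_le_1[of A] by (simp add: power_le_one)
  have sq': "\<delta>/2 * (measure N A)\<^sup>2 \<le> \<delta>/2" for A
    using mult_left_mono[OF sq[of A], of "\<delta>/2"] \<delta> by simp
  have bdd: "bdd_below (\<phi> ` Collect good)"
  proof (rule bdd_belowI2)
    fix A assume "A \<in> Collect good"
    then have "v - 1 \<le> F A" using F_left[of A] measure_le_1[of A] t(1) by simp
    then show "v - 1 - \<delta>/2 \<le> \<phi> A" using sq'[of A] by (simp add: \<phi>_def)
  qed
  define m where "m = Inf (\<phi> ` Collect good)"
  have m_le: "m \<le> \<phi> A" if "good A" for A
    unfolding m_def using bdd that by (intro cInf_lower) auto
  have A0_good: "good A0" using A0 t by (simp add: good_def b_def)
  have "F A0 = v - \<delta>" by (simp add: \<delta>_def)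
  moreover have "0 \<le> \<delta>/2 * (measure N A0)\<^sup>2" using \<delta> by simp
  ultimately have "m \<le> v - \<delta>"
    using m_le[OF A0_good] unfolding \<phi>_def by linarith
  \<comment> \<open>The first bound keeps the near-minimiser off the ends; the second is the gain
    per set from the quadratic term at \<open>a - s\<close> and \<open>a + s\<close>.\<close>
  define \<epsilon> where "\<epsilon> = min (\<delta>/4) (\<delta>/2 * s\<^sup>2)"
  have "\<epsilon> > 0" using \<delta> s by (simp add: \<epsilon>_def)
  then have lt: "Inf (\<phi> ` Collect good) < m + \<epsilon>" by (simp add: m_def)
  have "\<phi> ` Collect good \<noteq> {}" using A0_good by blast
  from cInf_lessD[OF this lt] obtain A where A: "good A" "\<phi> A < m + \<epsilon>"
    by (elim bexE imageE) simp
  define a where "a = measure N A"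
  have "\<epsilon> \<le> \<delta>/4" by (simp add: \<epsilon>_def)
  \<comment> \<open>Of the deficit \<open>\<delta>\<close>, the quadratic term uses at most
    \<open>\<delta>/2\<close> and \<open>\<epsilon>\<close> at most
    \<open>\<delta>/4\<close>.\<close>
  then have "F A < v - \<delta>/4"
    using A(2) sq'[of A] \<open>m \<le> v - \<delta>\<close> by (simp add: \<phi>_def)
  then have dist: "\<delta>/4 < a - t" "\<delta>/4 < 1 - b + t - a"
    using F_left[OF A(1)] F_right[OF A(1)] by (simp_all add: a_def)
  have "\<delta>/4 \<le> a" "\<delta>/4 \<le> 1 - a" using dist t by (auto simp: b_def)
  then have "(\<delta>/4)\<^sup>2 \<le> a * (1 - a)" "(\<delta>/4)\<^sup>2 \<le> \<delta>/4"
    using \<delta> mult_mono[of "\<delta>/4" a "\<delta>/4" "1 - a"] mult_left_mono[of "\<delta>/4" 1 "\<delta>/4"]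
    by (auto simp: power2_eq_square)
  moreover have "a * (1 - a) = a - a\<^sup>2" by (simp add: power2_eq_square algebra_simps)
  moreover have "0 < (\<delta>/4)\<^sup>2" using \<delta> by simp
  ultimately have s_le: "s \<le> \<delta>/4" "a\<^sup>2 < a - s" unfolding s_def by linarith+
  have A_sets: "A \<in> sets borel" using A(1) by (simp add: good_def)
  have "\<exists>x. measure N (A \<inter> {y. y - x \<in> A}) = a - s"
    using s_le(2) s by (intro exists_translate_Int conn A_sets) (simp_all add: a_def)
  then obtain x where x: "measure N (A \<inter> {y. y - x \<in> A}) = a - s" by (elim exE)
  let ?T = "{y. y - x \<in> A}"
  have T: "?T \<in> sets borel" using A_sets by (rule vimage_diff_borel)
  have "measure N (A \<union> ?T) = measure N A + measure N ?T - measure N (A \<inter> ?T)"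
    using A_sets T by (intro measure_Un3) (auto simp: fmeasurable_eq_sets)
  then have U: "measure N (A \<union> ?T) = a + s"
    using x measure_translate[OF A_sets, of x] by (simp add: a_def)
  have "good (A \<inter> ?T)" "good (A \<union> ?T)"
    using A_sets T x U dist s_le s \<delta> by (auto simp: good_def)
  then have "2 * m \<le> \<phi> (A \<inter> ?T) + \<phi> (A \<union> ?T)" using m_le by (smt (verit))
  also have "\<dots> \<le> 2 * F A - \<delta>/2 * ((a - s)\<^sup>2 + (a + s)\<^sup>2)"
  proof -
    have "(LINT z|N. min (set_conv ?T B z) t) = (LINT z|N. min (set_conv A B z) t)"
      unfolding set_conv_translate
      using integral_translate[of "\<lambda>z. min (set_conv A B z) t" x] measurable_set_conv[OF A_sets B] by simp
    then have "F (A \<inter> ?T) + F (A \<union> ?T) \<le> 2 * F A"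
      using min_set_conv_submodular[OF A_sets T B, of t] unfolding F_def x U by (simp add: a_def algebra_simps)
    then show ?thesis by (simp add: \<phi>_def x U algebra_simps)
  qed
  also have "\<dots> = 2 * \<phi> A - 2 * (\<delta>/2 * s\<^sup>2)"
    by (simp add: \<phi>_def a_def power2_eq_square algebra_simps)
  also have "\<dots> < 2 * m" using A(2) by (simp add: \<epsilon>_def)
  finally show False by simp
qed

section \<open>The inequality for Borel sets\<close>

text \<open>On \<open>C\<close> the convolution is at most \<open>t\<close> plus its excess over
  \<open>t\<close>, and the nonnegative excess may be integrated over the whole group. With
  \<open>measure N C = measure N A + measure N B - 2 * t\<close> the bound collapses to the product
  minus \<open>t\<^sup>2\<close>.\<close>

lemma riesz_sobolev_borel:
  assumes "connected (UNIV :: 'a set)"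
    and A: "A \<in> sets borel" and B: "B \<in> sets borel" and C: "C \<in> sets borel"
    and abc: "\<bar>measure N A - measure N B\<bar> \<le> measure N C"
      "measure N C \<le> measure N A + measure N B" "measure N A + measure N B + measure N C \<le> 2"
  shows "(LINT x|N. indicator C x * set_conv A B x)
    \<le> measure N A * measure N B - 1/4 * (measure N A + measure N B - measure N C)\<^sup>2"
proof -
  define t where "t = (measure N A + measure N B - measure N C) / 2"
  \<comment> \<open>These are the hypotheses restated: \<open>c <= a + b\<close> is the first,
    \<open>|a - b| <= c\<close> the next two, \<open>a + b + c <= 2\<close> the last.\<close>
  have t: "0 \<le> t" "t \<le> measure N B" "t \<le> measure N A" "measure N A + measure N B - t \<le> 1"
    using abc by (auto simp: t_def field_simps abs_le_iff)
  have iC: "integrable N (\<lambda>x. t * indicator C x)"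
    using C by (intro integrable_mult_right integrable_real_indicator) (auto simp: emeasure_eq_measure)
  have "(LINT x|N. indicator C x * set_conv A B x) \<le> (LINT x|N. t * indicator C x + (set_conv A B x - min (set_conv A B x) t))"
  proof (rule integral_mono)
    show "integrable N (\<lambda>x. indicator C x * set_conv A B x)"
      using integrable_real_mult_indicator[OF _ integrable_set_conv[OF A B], of C] C by (simp add: mult.commute)
    show "integrable N (\<lambda>x. t * indicator C x + (set_conv A B x - min (set_conv A B x) t))"
      by (intro Bochner_Integration.integrable_add Bochner_Integration.integrable_diff iC integrable_set_conv integrable_min_set_conv A B)
    show "indicator C x * set_conv A B x \<le> t * indicator C x + (set_conv A B x - min (set_conv A B x) t)" for x
      using t(1) by (auto simp: indicator_def)
  qed
  also have "\<dots> = t * measure N C + (measure N A * measure N B - (LINT x|N. min (set_conv A B x) t))"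
    using iC integrable_set_conv[OF A B] integrable_min_set_conv[OF A B] C
    by (simp add: integral_set_conv[OF A B])
  also have "\<dots> \<le> t * measure N C + (measure N A * measure N B - t * (measure N A + measure N B - t))"
    using kneser_pollard[OF assms(1) A B t] by simp
  also have "\<dots> = measure N A * measure N B - t\<^sup>2"
    by (simp add: t_def power2_eq_square field_simps)
  also have "t\<^sup>2 = 1/4 * (measure N A + measure N B - measure N C)\<^sup>2"
    by (simp add: t_def power2_eq_square)
  finally show ?thesis .
qed

section \<open>Passage to the completed measure\<close>

text \<open>Reflection preserves Borel sets and, by \<open>measure_reflect\<close>, null sets, hence
  also unions of a Borel set with a subset of a null set.\<close>

lemma vimage_reflect_completion:
  assumes A: "A \<in> sets (completion N)"
  shows "{y. x - y \<in> A} \<in> sets (completion N)"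
proof -
  obtain S Z Z' where Z: "A = S \<union> Z" "Z \<subseteq> Z'" "Z' \<in> null_sets N" "S \<in> sets N"
    using A by (rule sets_completionE)
  have Z': "Z' \<in> sets borel" using Z(3) by (simp add: null_sets_def)
  have "measure N {y. x - y \<in> Z'} = 0"
    using measure_reflect[OF Z', of x] Z(3) by (simp add: null_sets_def measure_def)
  then have "{y. x - y \<in> Z'} \<in> null_sets N"
    using vimage_diff_borel(1)[OF Z'] by (simp add: null_sets_def emeasure_eq_measure)
  moreover have "{y. x - y \<in> A} = {y. x - y \<in> S} \<union> {y. x - y \<in> Z}" using Z(1) by auto
  moreover have "{y. x - y \<in> S} \<in> sets N" using vimage_diff_borel(1) Z(4) by simp
  ultimately show ?thesis using Z(2) by (intro sets_completionI) auto
qed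

lemma AE_reflect:
  assumes "AE y in N. P y"
  shows "AE y in N. P (x - y)"
proof -
  obtain Z where Z: "Z \<in> sets N" "emeasure N Z = 0" "{y \<in> space N. \<not> P y} \<subseteq> Z"
    using assms by (rule AE_E)
  have "emeasure N {y. x - y \<in> Z} = 0"
    using Z measure_reflect[of Z x] by (simp add: emeasure_eq_measure)
  then have "{y. x - y \<in> Z} \<in> null_sets N"
    using vimage_diff_borel(1) Z(1) by (simp add: null_sets_def)
  then show ?thesis using Z(3) by (intro AE_I') auto
qed

lemma main_part_borel: "A \<in> sets (completion N) \<Longrightarrow> main_part N A \<in> sets borel"
  using main_part_sets[of A N] by (simp only: sets_N)

text \<open>For each fixed \<open>x\<close>, passing to the Borel main parts changes the integrand
  only on a null set, so the two functions agree at every point and not just almost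
  everywhere.\<close>

lemma group_convolution_indicator:
  assumes A: "A \<in> sets (completion N)" and B: "B \<in> sets (completion N)"
  shows "group_convolution (completion N) (indicator A) (indicator B) x
    = set_conv (main_part N A) (main_part N B) x"
proof -
  let ?E = "{y \<in> main_part N B. x - y \<in> main_part N A}"
  let ?E' = "{y \<in> B. x - y \<in> A}"
  have E: "?E \<in> sets N" using set_conv_sets[OF main_part_borel[OF A] main_part_borel[OF B]] by (simp only: sets_N)
  have E': "?E' \<in> sets (completion N)"
    using sets.Int[OF B vimage_reflect_completion[OF A, of x]] by (simp add: Int_def)
  have "AE y in N. (x - y \<in> main_part N A \<longleftrightarrow> x - y \<in> A)"
    using AE_reflect[OF AE_in_main_part[OF A]] .
  then have "AE y in N. (y \<in> ?E' \<longleftrightarrow> y \<in> ?E)"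
    using AE_in_main_part[OF B] by eventually_elim auto
  then have AE: "AE y in completion N. (y \<in> ?E' \<longleftrightarrow> y \<in> ?E)" by (rule AE_completion)
  have "group_convolution (completion N) (indicator A) (indicator B) x
      = (LINT y|completion N. indicator ?E' y)"
    unfolding group_convolution_def
    by (intro Bochner_Integration.integral_cong) (auto simp: indicator_def)
  also have "\<dots> = measure (completion N) ?E'" by simp
  also have "\<dots> = measure (completion N) ?E"
    using AE E' E by (intro measure_eq_AE) (auto simp del: sets_N)
  also have "\<dots> = set_conv (main_part N A) (main_part N B) x"
    using E by (simp add: set_conv_def)
  finally show ?thesis .
qed

text \<open>Main parts keep the measures of all three sets, and replacing \<open>C\<close> by its
  main part alters the integrand only on a null set, so the Borel case applies.\<close>

lemma riesz_sobolev:
  fixes A B C :: "'a set"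
  assumes conn: "connected (UNIV :: 'a set)"
    and A: "A \<in> sets (completion N)" and B: "B \<in> sets (completion N)" and C: "C \<in> sets (completion N)"
    and abc: "a = measure (completion N) A" "b = measure (completion N) B" "c = measure (completion N) C"
      "\<bar>a - b\<bar> \<le> c" "c \<le> a + b" "a + b + c \<le> 2"
  shows "(LINT x:C|completion N. group_convolution (completion N) (indicator A) (indicator B) x)
    \<le> a * b - 1/4 * (a + b - c)\<^sup>2"
proof -
  let ?f = "set_conv (main_part N A) (main_part N B)"
  have parts: "main_part N A \<in> sets borel" "main_part N B \<in> sets borel" "main_part N C \<in> sets borel"
    by (intro main_part_borel A B C)+
  have m: "a = measure N (main_part N A)" "b = measure N (main_part N B)" "c = measure N (main_part N C)"
    using A B C abc(1-3) by (simp_all add: measure_def)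
  have f: "?f \<in> borel_measurable N" using parts by (intro measurable_set_conv)
  have "(LINT x:C|completion N. group_convolution (completion N) (indicator A) (indicator B) x)
      = (LINT x|completion N. indicator C x * ?f x)"
    unfolding set_lebesgue_integral_def group_convolution_indicator[OF A B] by simp
  also have "\<dots> = (LINT x|completion N. indicator (main_part N C) x * ?f x)"
  proof (rule integral_cong_AE)
    show "(\<lambda>x. indicator C x * ?f x) \<in> borel_measurable (completion N)"
      using C measurable_completion[OF f] by measurable
    show "(\<lambda>x. indicator (main_part N C) x * ?f x) \<in> borel_measurable (completion N)"
      using f parts(3) by (intro measurable_completion) (measurable, simp)
    show "AE x in completion N. indicator C x * ?f x = indicator (main_part N C) x * ?f x"
      using AE_completion[OF AE_in_main_part[OF C]] by eventually_elim (auto simp: indicator_def)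
  qed
  also have "\<dots> = (LINT x|N. indicator (main_part N C) x * ?f x)"
    using f parts(3) by (intro integral_completion) (measurable, simp)
  also have "\<dots> \<le> a * b - 1/4 * (a + b - c)\<^sup>2"
    using riesz_sobolev_borel[OF conn parts] abc(4-6) unfolding m by blast
  finally show ?thesis .
qed

end

theorem theorem1p2:
  fixes \<mu> :: "'a::topological_ab_group_add measure"
    and A B C :: "'a set"
    and a b c :: real
  assumes "compact (UNIV :: 'a set)"
    and "connected (UNIV :: 'a set)"
    and "haar_measure \<mu>"
    and "emeasure \<mu> UNIV = 1"
    and "A \<in> sets \<mu>" and "B \<in> sets \<mu>" and "C \<in> sets \<mu>"
    and "a = measure \<mu> A" and "b = measure \<mu> B" and "c = measure \<mu> C"
    and "\<bar>a - b\<bar> \<le> c" and "c \<le> a + b"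
    and "a + b + c \<le> 2"
  shows "(LINT x:C|\<mu>. group_convolution \<mu> (indicator A) (indicator B) x)
           \<le> 1/2 * (a * b + b * c + c * a) - 1/4 * (a\<^sup>2 + b\<^sup>2 + c\<^sup>2)
       \<and> 1/2 * (a * b + b * c + c * a) - 1/4 * (a\<^sup>2 + b\<^sup>2 + c\<^sup>2)
           = a * b - 1/4 * (a + b - c)\<^sup>2"
proof
  obtain N where N: "borel_haar_measure N" "\<mu> = completion N"
    using assms(3) unfolding haar_measure_def by blast
  have sp: "space N = UNIV"
    using N(1) sets_eq_imp_space_eq[of N borel] by (simp add: borel_haar_measure_def)
  then have one: "emeasure N UNIV = 1"
    using assms(4) N(2) emeasure_completion[of UNIV N] main_part[of UNIV N] sets.top[of N] by simp
  have "finite_measure N" by (rule finite_measureI) (simp add: one sp)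
  then interpret compact_borel_haar N
    by (intro compact_borel_haar.intro compact_borel_haar_axioms.intro assms(1) N(1) one)
  show eq: "1/2 * (a * b + b * c + c * a) - 1/4 * (a\<^sup>2 + b\<^sup>2 + c\<^sup>2)
      = a * b - 1/4 * (a + b - c)\<^sup>2"
    by (simp add: power2_eq_square field_simps)
  show "(LINT x:C|\<mu>. group_convolution \<mu> (indicator A) (indicator B) x)
      \<le> 1/2 * (a * b + b * c + c * a) - 1/4 * (a\<^sup>2 + b\<^sup>2 + c\<^sup>2)"
    unfolding eq unfolding N(2)
    by (rule riesz_sobolev[OF assms(2) assms(5-10)[unfolded N(2)] assms(11-13)])
qed

end
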